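(* Let $R$ be a non-negative symmetric matrix of order $n$ with spectral radius $\rho$ such that $\eta(R)=\kappa$. Then $$\mathcal{E}(R)\ \geq\ \rho+n-\kappa-1+\ln\bigl|\Upsilon_{n-\kappa}(R)\bigr|-\ln\rho .\qquad ( * )$$ Equality holds in $( * )$ if and only if the nonzero eigenvalues of $R$ have all modulus equal to $1$, except maybe for its largest eigenvalue. Moreover, if $R$ has largest eigenvalue greater than $1$ and $\operatorname{tr}(R)=0$, then $\kappa$, the number $c$ of eigenvalues equal to $-1$, and the number $f$ of eigenvalues equal to $1$ satisfy: 1. $c=\dfrac{|R|^{2}-\rho^{2}+\rho}{2}$; 2. $f=\dfrac{|R|^{2}-\rho^{2}-\rho}{2}$; 3. $\kappa=n-1+\rho^{2}-|R|^{2}$. Moreover, the inequality $( * )$ is strict if $R$ has a submatrix of order $3$, say $R_1$, where either 1. $R_1=\begin{pmatrix} 0 & a & 0 \\ a & 0 & b \\ 0 & b & 0 \end{pmatrix}$ with $\sqrt{a^{2}+b^{2}}>1$, or 2. $R_1=\begin{pmatrix} 0 & a & c \\ a & 0 & b \\ c & b & 0 \end{pmatrix}$ with a vector $(\alpha,\beta,\gamma)^{T}$ such that $$\frac{2(a\alpha\beta+b\beta\gamma+c\alpha\gamma)}{\sqrt{\alpha^{2}+\beta^{2}+\gamma^{2}}}<-1 .$$ (In the last item $c$ denotes a matrix entry.)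
   Context: For a Hermitian matrix $R$, the energy $\mathcal{E}(R)$ is the sum of the absolute values of its eigenvalues. The nullity $\eta(R)$ is the multiplicity of $0$ as an eigenvalue of $R$. $|R|$ denotes the Frobenius norm, the square root of the sum of the squares of the singular values, so for symmetric $R$ the number $|R|^2$ is the sum of the squares of the absolute values of the eigenvalues of $R$. For a non-negative symmetric matrix the spectral radius $\rho$ coincides with the largest eigenvalue. $\operatorname{tr}$ denotes the trace. For a square matrix $M$ of order $n$ with eigenvalues $\mu_1,\dots,\mu_n$, $\Upsilon_k(M)=\sum_{1\le i_1<\cdots<i_k\le n}\mu_{i_1}\mu_{i_2}\cdots\mu_{i_k}$ is the $k$-th elementary symmetric sum of the eigenvalues.
   Formalization: R is assumed nonzero (ln ρ is undefined otherwise); the formulas for c, f, κ are stated only when equality holds in ( * ) (the path P_3 refutes them otherwise); in the last item the denominator is α²+β²+γ² without the square root (K_3 with (10,-10,0) refutes the printed form). *)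

theory Defs
  imports
    "HOL-Analysis.Analysis"
    "Jordan_Normal_Form.Schur_Decomposition"
    "Jordan_Normal_Form.Spectral_Radius"
    "Jordan_Normal_Form.DL_Submatrix"
begin

(* All eigenvalues, repeated according to algebraic multiplicity, in an unspecified order;
   the notions below do not depend on that order. *)
definition eigvals :: "complex mat \<Rightarrow> complex list" where
  "eigvals A = (SOME es. char_poly A = (\<Prod>e\<leftarrow>es. [:- e, 1:]))"

lemma eigvals:
  assumes "A \<in> carrier_mat n n"
  shows "char_poly A = (\<Prod>e\<leftarrow>eigvals A. [:- e, 1:])" and "length (eigvals A) = n"
proof -
  obtain es where "char_poly A = (\<Prod>e\<leftarrow>es. [:- e, 1:])"
    using char_poly_factorized[OF assms] by blast
  then show *: "char_poly A = (\<Prod>e\<leftarrow>eigvals A. [:- e, 1:])"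
    unfolding eigvals_def by (rule someI)
  show "length (eigvals A) = n"
    using degree_monic_char_poly[OF assms] degree_linear_factors[of uminus "eigvals A"] *
    by simp
qed

definition mat_energy :: "complex mat \<Rightarrow> real" where
  "mat_energy A = (\<Sum>e\<leftarrow>eigvals A. cmod e)"

definition mat_nullity :: "complex mat \<Rightarrow> nat" where
  "mat_nullity A = order 0 (char_poly A)"

definition esym_eigvals :: "nat \<Rightarrow> complex mat \<Rightarrow> complex" where
  "esym_eigvals k A =
     (\<Sum>S | S \<subseteq> {..<dim_row A} \<and> card S = k. \<Prod>i\<in>S. eigvals A ! i)"

(* The eigenvalues of the positive semidefinite matrix A\<^sup>H A are real, so Re only changes the type. *)
definition singular_values :: "complex mat \<Rightarrow> real list" where
  "singular_values A = map (\<lambda>e. sqrt (Re e)) (eigvals (mat_adjoint A * A))"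

definition frobenius_norm :: "complex mat \<Rightarrow> real" where
  "frobenius_norm A = sqrt (\<Sum>s\<leftarrow>singular_values A. s\<^sup>2)"

definition mat_trace :: "'a::comm_monoid_add mat \<Rightarrow> 'a" where
  "mat_trace A = (\<Sum>i<dim_row A. A $$ (i, i))"

(* Only used for real symmetric matrices of positive order, all of whose eigenvalues are real. *)
definition largest_eigenvalue :: "real mat \<Rightarrow> real" where
  "largest_eigenvalue R = Max {x. eigenvalue R x}"

end

theory Submission
  imports Defs
begin

text \<open>
  After diagonalising \<open>R\<close> orthogonally, the eigenvalue of largest modulus is \<open>\<rho>\<close> itself: passing to the
  absolute values of an eigenvector does not decrease the Rayleigh quotient of a non-negative matrix.
  If \<open>y\<close> runs over the other nonzero eigenvalues, then the two sides of the bound differ by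
  \<open>\<Sum> (\<bar>y\<bar> - 1 - ln \<bar>y\<bar>)\<close>, a sum of non-negative terms that vanish exactly when \<open>\<bar>y\<bar> = 1\<close>. In the case of
  equality, the trace and the Frobenius norm give linear equations for the numbers of \<open>1\<close> and \<open>- 1\<close>.
  A submatrix as in the last part has, by the same argument on Rayleigh quotients, two eigenvalues of
  modulus greater than \<open>1\<close>, hence so does \<open>R\<close>. The path pattern is the triangle pattern with \<open>c = 0\<close> and test
  vector \<open>(a, - sqrt (a\<^sup>2 + b\<^sup>2), b)\<close>.
\<close>

unbundle no vec_syntax
unbundle no inner_syntax

section \<open>Orthogonal diagonalisation of real symmetric matrices\<close>

text \<open>Column \<open>k\<close> of \<open>U\<close> is a unit eigenvector for
  \<open>d k\<close>. Since \<open>d\<close> may repeat values, multiplicities of eigenvalues become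
  counts of indices below the order.\<close>

definition orth_diag :: "real mat \<Rightarrow> (nat \<Rightarrow> real) \<Rightarrow> real mat \<Rightarrow> bool" where
  "orth_diag U d R \<longleftrightarrow> U \<in> carrier_mat (dim_row R) (dim_row R) \<and>
     U\<^sup>T * U = 1\<^sub>m (dim_row R) \<and> U * U\<^sup>T = 1\<^sub>m (dim_row R) \<and>
     R = U * mat_diag (dim_row R) d * U\<^sup>T"

lemma orth_diagD:
  assumes "orth_diag U d R" "R \<in> carrier_mat n n"
  shows "U \<in> carrier_mat n n" "U\<^sup>T * U = 1\<^sub>m n" "U * U\<^sup>T = 1\<^sub>m n" "R = U * mat_diag n d * U\<^sup>T"
  using assms by (auto simp: orth_diag_def)

section \<open>Existence by deflation with Householder reflections\<close>

lemma scalar_prod_self_pos: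
  fixes v :: "real vec"
  assumes "v \<in> carrier_vec n" "v \<noteq> 0\<^sub>v n"
  shows "v \<bullet> v > 0"
proof -
  have "v \<bullet>c v > 0" using conjugate_square_greater_0_vec[of v n] assms by simp
  then show ?thesis by simp
qed

text \<open>The reflection in the hyperplane orthogonal to \<open>v - unit_vec n 0\<close> exchanges
  the two unit vectors. It degenerates when they coincide, where the identity serves
  instead.\<close>

lemma householder_exists:
  fixes v :: "real vec"
  assumes v: "v \<in> carrier_vec n" and n: "0 < n" and norm: "v \<bullet> v = 1"
  shows "\<exists>W \<in> carrier_mat n n. W\<^sup>T = W \<and> W * W = 1\<^sub>m n \<and> col W 0 = v"
proof (cases "v = unit_vec n 0")
  case True
  then show ?thesis using n by (intro bexI[of _ "1\<^sub>m n"]) auto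
next
  case False
  define w where "w = v - unit_vec n 0"
  \<comment> \<open>The Householder factor \<open>2 / (w \<bullet> w)\<close>: as \<open>v\<close>
    and \<open>unit_vec n 0\<close> have norm \<open>1\<close>, the denominator is
    \<open>2 * (1 - v $ 0)\<close>.\<close>
  define c where "c = 1 / (1 - v $ 0)"
  have w: "w \<in> carrier_vec n" using v by (simp add: w_def)
  have "w \<noteq> 0\<^sub>v n"
  proof
    assume "w = 0\<^sub>v n"
    then have "w $ i = 0" if "i < n" for i using that by simp
    then have "v = unit_vec n 0" using v by (intro eq_vecI) (auto simp: w_def)
    with False show False ..
  qed
  then have "w \<bullet> w > 0" using scalar_prod_self_pos[OF w] by simp
  moreover have ww: "w \<bullet> w = 2 * (1 - v $ 0)"
  proof -
    have "w \<bullet> w = v \<bullet> v - v \<bullet> unit_vec n 0 - (unit_vec n 0 \<bullet> v - unit_vec n 0 \<bullet> unit_vec n 0)"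
      using v unfolding w_def
      by (simp add: minus_scalar_prod_distrib[of _ n] scalar_prod_minus_distrib[of _ n])
    then show ?thesis using v n norm by simp
  qed
  ultimately have v0: "1 - v $ 0 > 0" by simp
  define W where "W = mat n n (\<lambda>(i,j). (if i = j then 1 else 0) - c * w $ i * w $ j)"
  have W: "W \<in> carrier_mat n n" by (simp add: W_def)
  have sum: "(\<Sum>k<n. w $ k * w $ k) = 2 * (1 - v $ 0)"
    using ww w by (simp add: scalar_prod_def atLeast0LessThan)
  have "W\<^sup>T = W" by (rule eq_matI) (auto simp: W_def)
  moreover have "W * W = 1\<^sub>m n"
  proof (rule eq_matI)
    fix i j assume "i < dim_row (1\<^sub>m n :: real mat)" "j < dim_col (1\<^sub>m n :: real mat)"
    then have ij: "i < n" "j < n" by auto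
    let ?\<delta> = "\<lambda>a b. if a = b then 1 else 0 :: real"
    have "(W * W) $$ (i,j) = (\<Sum>k<n. (?\<delta> i k - c * w $ i * w $ k) * (?\<delta> k j - c * w $ k * w $ j))"
      using ij by (simp add: W_def scalar_prod_def atLeast0LessThan)
    also have "\<dots> = (\<Sum>k<n. ?\<delta> i k * ?\<delta> k j) - (\<Sum>k<n. ?\<delta> i k * (c * w $ k * w $ j))
        - (\<Sum>k<n. ?\<delta> k j * (c * w $ i * w $ k)) + c * c * w $ i * w $ j * (\<Sum>k<n. w $ k * w $ k)"
      by (simp add: sum_distrib_left sum.distrib[symmetric] sum_subtractf[symmetric] algebra_simps
               cong: if_cong)
    also have "\<dots> = ?\<delta> i j - 2 * c * w $ i * w $ j + c * c * w $ i * w $ j * (2 * (1 - v $ 0))"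
      using ij by (simp add: sum if_distrib[of "\<lambda>x. x * _"] sum.delta sum.delta' cong: if_cong)
    also have "\<dots> = ?\<delta> i j - 2 * c * w $ i * w $ j * (1 - c * (1 - v $ 0))"
      by (simp only: algebra_simps)
    also have "c * (1 - v $ 0) = 1" using v0 by (simp add: c_def)
    also have "?\<delta> i j - 2 * c * w $ i * w $ j * (1 - 1) = ?\<delta> i j" by simp
    finally show "(W * W) $$ (i,j) = 1\<^sub>m n $$ (i,j)" using ij by simp
  qed (auto simp: W_def)
  moreover have "col W 0 = v"
  proof (rule eq_vecI)
    fix i assume "i < dim_vec v"
    then have i: "i < n" using v by simp
    have "c * w $ 0 = - 1" using v v0 n by (simp add: w_def c_def field_simps)
    then have "c * w $ i * w $ 0 = - w $ i" by (metis mult.assoc mult.commute mult_minus1)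
    then show "col W 0 $ i = v $ i" using i n v by (auto simp: W_def) (auto simp: w_def)
  qed (use v W in auto)
  ultimately show ?thesis using W by blast
qed

text \<open>For a complex eigenvector \<open>v\<close>, the Hermitian form \<open>q\<close> equals
  \<open>a * s\<close>, where \<open>s\<close> is the squared norm of \<open>v\<close>. Symmetry of
  the real entries makes \<open>q\<close> its own conjugate, and \<open>s\<close> is real and
  nonzero, so \<open>a\<close> is its own conjugate too.\<close>

lemma real_symmetric_eigenvalue_real:
  fixes R :: "real mat"
  assumes R: "R \<in> carrier_mat n n" and sym: "R\<^sup>T = R"
    and ev: "eigenvalue (map_mat complex_of_real R) a"
  shows "a \<in> \<real>"
proof -
  obtain v where v: "v \<in> carrier_vec n" "v \<noteq> 0\<^sub>v n"
    and Av: "map_mat complex_of_real R *\<^sub>v v = a \<cdot>\<^sub>v v"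
    using ev R by (auto simp: eigenvalue_def eigenvector_def)
  have Rs: "R $$ (i,j) = R $$ (j,i)" if "i < n" "j < n" for i j
    using that R arg_cong[OF sym, of "\<lambda>M. M $$ (j,i)"] by simp
  have row: "(\<Sum>j<n. R $$ (i,j) * v $ j) = a * v $ i" if "i < n" for i
    using that R v arg_cong[OF Av, of "\<lambda>u. u $ i"] by (simp add: scalar_prod_def atLeast0LessThan)
  define q where "q = (\<Sum>i<n. \<Sum>j<n. cnj (v $ i) * R $$ (i,j) * v $ j)"
  define s where "s = (\<Sum>i<n. cnj (v $ i) * v $ i)"
  have "q = (\<Sum>i<n. cnj (v $ i) * (\<Sum>j<n. R $$ (i,j) * v $ j))"
    by (simp add: q_def sum_distrib_left mult.assoc)
  also have "\<dots> = (\<Sum>i<n. cnj (v $ i) * (a * v $ i))"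
    by (intro sum.cong refl) (simp only: row lessThan_iff)
  also have "\<dots> = a * s" by (simp add: s_def sum_distrib_left mult_ac)
  finally have q: "q = a * s" .
  have "cnj q = (\<Sum>i<n. \<Sum>j<n. v $ i * R $$ (i,j) * cnj (v $ j))"
    by (simp add: q_def)
  also have "\<dots> = (\<Sum>j<n. \<Sum>i<n. v $ i * R $$ (i,j) * cnj (v $ j))" by (rule sum.swap)
  also have "\<dots> = q" unfolding q_def by (intro sum.cong refl) (auto simp: Rs mult_ac)
  finally have "cnj q = q" .
  have s: "s = of_real (\<Sum>i<n. (cmod (v $ i))\<^sup>2)"
    by (simp add: s_def complex_norm_square mult.commute flip: of_real_power)
  obtain i where i: "i < n" "v $ i \<noteq> 0"
  proof (rule ccontr)
    assume "\<not> thesis"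
    then have "v = 0\<^sub>v n" using v that by (intro eq_vecI) auto
    with v show False by simp
  qed
  have "(\<Sum>i<n. (cmod (v $ i))\<^sup>2) > 0"
    by (rule sum_pos2[of _ i]) (use i in auto)
  then have "s \<noteq> 0" unfolding s of_real_eq_0_iff by simp
  have "cnj a * s = a * s" using \<open>cnj q = q\<close> q by (simp add: s)
  then have "cnj a = a" using \<open>s \<noteq> 0\<close> by simp
  then show ?thesis by (simp add: Reals_cnj_iff)
qed

text \<open>The complexified matrix has an eigenvalue, which is real by the previous lemma. It is
  therefore a root of the real characteristic polynomial and has a real eigenvector, which is then
  normalised.\<close>

lemma real_symmetric_unit_eigenvector:
  fixes R :: "real mat"
  assumes R: "R \<in> carrier_mat n n" and sym: "R\<^sup>T = R" and n: "0 < n"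
  shows "\<exists>v e. v \<in> carrier_vec n \<and> v \<bullet> v = 1 \<and> R *\<^sub>v v = e \<cdot>\<^sub>v v"
proof -
  let ?A = "map_mat complex_of_real R"
  have A: "?A \<in> carrier_mat n n" using R by simp
  obtain a where a: "eigenvalue ?A a" using spectrum_non_empty[OF A] n by (auto simp: spectrum_def)
  then obtain e where e: "a = of_real e"
    using real_symmetric_eigenvalue_real[OF R sym] by (auto elim: Reals_cases)
  have "poly (char_poly ?A) (of_real e) = 0" using a e eigenvalue_root_char_poly[OF A] by simp
  then have "poly (char_poly R) e = 0"
    by (simp add: of_real_hom.char_poly_hom[OF R])
  then have "eigenvalue R e" using eigenvalue_root_char_poly[OF R] by simp
  then obtain v where v: "v \<in> carrier_vec n" "v \<noteq> 0\<^sub>v n" "R *\<^sub>v v = e \<cdot>\<^sub>v v"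
    using R by (auto simp: eigenvalue_def eigenvector_def)
  have pos: "v \<bullet> v > 0" using scalar_prod_self_pos v by blast
  let ?u = "(1 / sqrt (v \<bullet> v)) \<cdot>\<^sub>v v"
  have "?u \<bullet> ?u = 1" using v pos by (simp add: field_simps)
  moreover have "R *\<^sub>v ?u = e \<cdot>\<^sub>v ?u"
    using v R by (simp add: mult_mat_vec smult_smult_assoc mult.commute)
  ultimately show ?thesis using v by (intro exI[of _ ?u] exI[of _ e]) simp
qed

lemma mat_diag_Suc:
  "mat_diag (Suc n) (case_nat e d) =
    four_block_mat (mat_diag 1 (\<lambda>_. e)) (0\<^sub>m 1 n) (0\<^sub>m n 1) (mat_diag n d)"
  by (rule eq_matI) (auto simp: mat_diag_def split: nat.splits)

text \<open>One reflection brings a unit eigenvector to the first axis, symmetry clears the first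
  row along with the first column, and the induction hypothesis diagonalises the remaining
  block.\<close>

lemma orth_diag_exists:
  fixes R :: "real mat"
  assumes "R \<in> carrier_mat n n" "R\<^sup>T = R"
  shows "\<exists>U d. orth_diag U d R"
  using assms
proof (induction n arbitrary: R)
  case 0
  then show ?case
    by (intro exI[of _ "1\<^sub>m 0"] exI) (auto simp: orth_diag_def)
next
  case (Suc n)
  note R = Suc.prems(1) and R_sym = Suc.prems(2)
  let ?N = "Suc n"
  obtain v e where v: "v \<in> carrier_vec ?N" "v \<bullet> v = 1" and ev: "R *\<^sub>v v = e \<cdot>\<^sub>v v"
    using real_symmetric_unit_eigenvector[OF R R_sym] by auto
  obtain W where W: "W \<in> carrier_mat ?N ?N" "W\<^sup>T = W" "W * W = 1\<^sub>m ?N" and W0: "col W 0 = v"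
    using householder_exists[OF v(1) _ v(2)] by auto
  \<comment> \<open>As \<open>W\<close> is symmetric and an involution, this is an orthogonal
    conjugation; \<open>W\<close> exchanges \<open>v\<close> with the first unit vector.\<close>
  define A where "A = W * R * W"
  have A: "A \<in> carrier_mat ?N ?N" using W R by (simp add: A_def)
  have "A\<^sup>T = W\<^sup>T * (R\<^sup>T * W\<^sup>T)"
    unfolding A_def using W R by (simp only: transpose_mult[of _ ?N ?N _ ?N] mult_carrier_mat[of _ ?N ?N _ ?N])
  then have symA: "A\<^sup>T = A" unfolding A_def using W R R_sym by simp
  have "col A 0 = e \<cdot>\<^sub>v unit_vec ?N 0"
  proof -
    have "col A 0 = (W * R) *\<^sub>v col W 0" unfolding A_def using W R by (intro col_mult2[of _ ?N ?N _ ?N]) auto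
    also have "\<dots> = W *\<^sub>v (R *\<^sub>v v)" unfolding W0 using W R v by simp
    also have "\<dots> = e \<cdot>\<^sub>v (W *\<^sub>v col W 0)" unfolding ev W0 using W v by (simp add: mult_mat_vec)
    also have "W *\<^sub>v col W 0 = col (W * W) 0" using W by (subst col_mult2[of _ ?N ?N _ ?N]) auto
    also have "\<dots> = unit_vec ?N 0" unfolding W(3) by simp
    finally show ?thesis .
  qed
  then have A0: "A $$ (i,0) = (if i = 0 then e else 0)" if "i < ?N" for i
    using that A by (auto dest: arg_cong[of _ _ "\<lambda>u. u $ i"])
  have A0': "A $$ (0,i) = (if i = 0 then e else 0)" if "i < ?N" for i
    using A0[OF that] that A arg_cong[OF symA, of "\<lambda>M. M $$ (0,i)"] by simp
  define A3 where "A3 = mat n n (\<lambda>(i,j). A $$ (Suc i, Suc j))"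
  have A3: "A3 \<in> carrier_mat n n" by (simp add: A3_def)
  have "A $$ (Suc i, Suc j) = A $$ (Suc j, Suc i)" if "i < n" "j < n" for i j
    using that A arg_cong[OF symA, of "\<lambda>M. M $$ (Suc i,Suc j)"] by simp
  then have "A3\<^sup>T = A3" by (intro eq_matI) (auto simp: A3_def)
  then obtain V d where "orth_diag V d A3" using Suc.IH[OF A3] by blast
  note V = orth_diagD[OF this A3]
  have A_block: "A = four_block_mat (mat_diag 1 (\<lambda>_. e)) (0\<^sub>m 1 n) (0\<^sub>m n 1) A3"
    by (rule eq_matI) (use A in \<open>auto simp: A0 A0' A3_def mat_diag_def\<close>)
  define Q where "Q = four_block_mat (1\<^sub>m 1) (0\<^sub>m 1 n) (0\<^sub>m n 1) V"
  have Q: "Q \<in> carrier_mat ?N ?N" using V(1) by (auto simp: Q_def)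
  have QT: "Q\<^sup>T = four_block_mat (1\<^sub>m 1) (0\<^sub>m 1 n) (0\<^sub>m n 1) V\<^sup>T"
    using V(1) unfolding Q_def by (subst transpose_four_block_mat[of _ 1 1 _ n _ n]) auto
  have mult: "four_block_mat X (0\<^sub>m 1 n) (0\<^sub>m n 1) Y * four_block_mat X' (0\<^sub>m 1 n) (0\<^sub>m n 1) Y'
      = four_block_mat (X * X') (0\<^sub>m 1 n) (0\<^sub>m n 1) (Y * Y')"
    if "X \<in> carrier_mat 1 1" "X' \<in> carrier_mat 1 1" "Y \<in> carrier_mat n n" "Y' \<in> carrier_mat n n"
    for X X' Y Y' :: "real mat"
    using that by (subst mult_four_block_mat[of _ 1 1 _ n _ n _ _ 1 _ n]) auto
  have one: "four_block_mat (1\<^sub>m 1) (0\<^sub>m 1 n) (0\<^sub>m n 1) (1\<^sub>m n) = (1\<^sub>m ?N :: real mat)"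
    by (simp add: four_block_one_mat[of 1 n, simplified])
  have QTQ: "Q\<^sup>T * Q = 1\<^sub>m ?N"
    unfolding QT using V(1) one unfolding Q_def by (subst mult) (auto simp: V(2))
  have AQ: "A = Q * mat_diag ?N (case_nat e d) * Q\<^sup>T"
  proof -
    have "Q * mat_diag ?N (case_nat e d) =
        four_block_mat (1\<^sub>m 1 * mat_diag 1 (\<lambda>_. e)) (0\<^sub>m 1 n) (0\<^sub>m n 1) (V * mat_diag n d)"
      unfolding Q_def mat_diag_Suc by (rule mult[OF _ _ V(1)]) simp_all
    also have "\<dots> * Q\<^sup>T = four_block_mat (1\<^sub>m 1 * mat_diag 1 (\<lambda>_. e) * 1\<^sub>m 1) (0\<^sub>m 1 n) (0\<^sub>m n 1)
        (V * mat_diag n d * V\<^sup>T)"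
      unfolding QT using V(1)
      by (intro mult mult_carrier_mat[of _ 1 1] mult_carrier_mat[of _ n n] mat_diag_dim one_carrier_mat) simp_all
    also have "1\<^sub>m 1 * mat_diag 1 (\<lambda>_. e) * 1\<^sub>m 1 = mat_diag 1 (\<lambda>_. e)"
      unfolding left_mult_one_mat[OF mat_diag_dim] right_mult_one_mat[OF mat_diag_dim] ..
    finally show ?thesis unfolding A_block V(4)[symmetric] by (rule sym)
  qed
  define U where "U = W * Q"
  have U: "U \<in> carrier_mat ?N ?N" unfolding U_def by (rule mult_carrier_mat[OF W(1) Q])
  have UT: "U\<^sup>T = Q\<^sup>T * W" unfolding U_def transpose_mult[OF W(1) Q] W(2) ..
  have QT': "Q\<^sup>T \<in> carrier_mat ?N ?N" using Q by simp
  note assoc = assoc_mult_mat[of _ ?N ?N _ ?N _ ?N] mult_carrier_mat[of _ ?N ?N _ ?N]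
  have "U\<^sup>T * U = Q\<^sup>T * ((W * W) * Q)" unfolding UT unfolding U_def
    by (simp only: assoc W(1) Q QT')
  also have "\<dots> = 1\<^sub>m ?N" unfolding W(3) left_mult_one_mat[OF Q] by (rule QTQ)
  finally have UTU: "U\<^sup>T * U = 1\<^sub>m ?N" .
  \<comment> \<open>Conjugating twice by the involution \<open>W\<close> returns \<open>R\<close>,
    so \<open>W * Q\<close> diagonalises \<open>R\<close> itself.\<close>
  have "W * A * W = (W * W) * R * (W * W)"
    unfolding A_def by (simp only: assoc W(1) R)
  then have "R = W * A * W"
    unfolding W(3) left_mult_one_mat[OF R] right_mult_one_mat[OF R] by (rule sym)
  also have "\<dots> = U * mat_diag ?N (case_nat e d) * U\<^sup>T"
    unfolding UT unfolding U_def AQ by (simp only: assoc W(1) Q QT' mat_diag_dim)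
  finally have "orth_diag U (case_nat e d) R"
    using U UTU mat_mult_left_right_inverse[OF _ U UTU] R unfolding orth_diag_def by simp
  then show ?case by blast
qed

section \<open>Norms and quadratic forms in eigenvector coordinates\<close>

lemma orth_diag_scalar_prod:
  assumes "orth_diag U d R" "R \<in> carrier_mat n n" "x \<in> carrier_vec n" "y \<in> carrier_vec n"
  shows "(U\<^sup>T *\<^sub>v x) \<bullet> (U\<^sup>T *\<^sub>v y) = x \<bullet> y"
proof -
  note U = orth_diagD[OF assms(1,2)]
  have "(U\<^sup>T *\<^sub>v x) \<bullet> (U\<^sup>T *\<^sub>v y) = x \<bullet> (U *\<^sub>v (U\<^sup>T *\<^sub>v y))"
    using U(1) assms by (intro transpose_vec_mult_scalar[of U n n]) auto
  also have "U *\<^sub>v (U\<^sup>T *\<^sub>v y) = (U * U\<^sup>T) *\<^sub>v y"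
    using U(1) assms(4) by (intro assoc_mult_mat_vec[of _ n n _ n, symmetric]) auto
  also have "\<dots> = y" unfolding U(3) by (rule one_mult_mat_vec[OF assms(4)])
  finally show ?thesis .
qed

lemma orth_diag_mult_vec:
  assumes "orth_diag U d R" "R \<in> carrier_mat n n" "x \<in> carrier_vec n"
  shows "U\<^sup>T *\<^sub>v (R *\<^sub>v x) = vec n (\<lambda>k. d k * (U\<^sup>T *\<^sub>v x) $ k)"
proof -
  note U = orth_diagD[OF assms(1,2)]
  define y where "y = U\<^sup>T *\<^sub>v x"
  have y: "y \<in> carrier_vec n" using U(1) assms(3) by (simp add: y_def)
  have "R *\<^sub>v x = U *\<^sub>v (mat_diag n d *\<^sub>v y)"
    unfolding y_def by (subst U(4)) (use U(1) assms(3) in \<open>simp add: assoc_mult_mat_vec[of _ n n _ n]\<close>)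
  then have "U\<^sup>T *\<^sub>v (R *\<^sub>v x) = (U\<^sup>T * U) *\<^sub>v (mat_diag n d *\<^sub>v y)"
    using U(1) y
    by (simp add: assoc_mult_mat_vec[of "U\<^sup>T" n n U n "mat_diag n d *\<^sub>v y"] mult_mat_vec_carrier[OF mat_diag_dim])
  also have "\<dots> = mat_diag n d *\<^sub>v y"
    unfolding U(2) by (rule one_mult_mat_vec[OF mult_mat_vec_carrier[OF mat_diag_dim y]])
  also have "\<dots> = vec n (\<lambda>k. d k * y $ k)"
    using y by (intro eq_vecI)
      (auto simp: mat_diag_def scalar_prod_def if_distrib[of "\<lambda>t. t * _"] cong: if_cong)
  finally show ?thesis by (simp add: y_def)
qed

lemma orth_diag_quadratic_form:
  assumes "orth_diag U d R" "R \<in> carrier_mat n n" "x \<in> carrier_vec n"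
  shows "x \<bullet> (R *\<^sub>v x) = (\<Sum>k<n. d k * ((U\<^sup>T *\<^sub>v x) $ k)\<^sup>2)"
proof -
  have "U \<in> carrier_mat n n" using orth_diagD[OF assms(1,2)] by simp
  then show ?thesis
    using assms orth_diag_scalar_prod[OF assms(1-3), of "R *\<^sub>v x"]
    by (simp add: orth_diag_mult_vec[OF assms] scalar_prod_def atLeast0LessThan power2_eq_square mult_ac)
qed

lemma orth_diag_norm_sq:
  assumes "orth_diag U d R" "R \<in> carrier_mat n n" "x \<in> carrier_vec n"
  shows "x \<bullet> x = (\<Sum>k<n. ((U\<^sup>T *\<^sub>v x) $ k)\<^sup>2)"
  using orth_diag_scalar_prod[OF assms assms(3)] orth_diagD(1)[OF assms(1,2)]
  by (simp add: scalar_prod_def atLeast0LessThan power2_eq_square)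

lemma orth_diag_mult_vec_norm_sq:
  assumes "orth_diag U d R" "R \<in> carrier_mat n n" "x \<in> carrier_vec n"
  shows "(R *\<^sub>v x) \<bullet> (R *\<^sub>v x) = (\<Sum>k<n. (d k)\<^sup>2 * ((U\<^sup>T *\<^sub>v x) $ k)\<^sup>2)"
proof -
  have "R *\<^sub>v x \<in> carrier_vec n" using assms by simp
  from orth_diag_norm_sq[OF assms(1,2) this] show ?thesis
    by (simp add: orth_diag_mult_vec[OF assms] power_mult_distrib)
qed

lemma orth_diag_col:
  assumes "orth_diag U d R" "R \<in> carrier_mat n n" "m < n"
  shows "U\<^sup>T *\<^sub>v col U m = unit_vec n m"
  using orth_diagD[OF assms(1,2)] assms(3) col_mult2[of "U\<^sup>T" n n U n m] by simp

text \<open>A weak Perron-Frobenius bound. For the unit eigenvector \<open>u\<close> of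
  \<open>d l\<close>, non-negative entries give \<open>\<bar>u \<bullet> (R *\<^sub>v u)\<bar> \<le>
  w \<bullet> (R *\<^sub>v w)\<close>, where \<open>w\<close> holds the absolute values of
  \<open>u\<close>. As \<open>w\<close> has norm \<open>1\<close> too, its Rayleigh quotient is at
  most the largest \<open>d m\<close>.\<close>

lemma nonneg_symmetric_max_eigenvalue:
  assumes "orth_diag U d R" and R: "R \<in> carrier_mat n n" and l: "l < n"
    and nonneg: "\<And>i j. i < n \<Longrightarrow> j < n \<Longrightarrow> 0 \<le> R $$ (i,j)"
  shows "\<exists>m<n. \<bar>d l\<bar> \<le> d m"
proof -
  note U = orth_diagD[OF assms(1,2)]
  define m where "m = (ARG_MAX d k. k < n)"
  have max: "m < n" "\<And>k. k < n \<Longrightarrow> d k \<le> d m"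
  proof -
    have "Max (d ` {..<n}) \<in> d ` {..<n}" using l by (intro Max_in) auto
    then obtain k0 where "k0 < n" "d k0 = Max (d ` {..<n})" by auto
    then have "is_arg_max d (\<lambda>k. k < n) k0"
      unfolding is_arg_max_linorder by auto
    then have "is_arg_max d (\<lambda>k. k < n) m"
      unfolding m_def arg_max_def by (rule someI)
    then show "m < n" "\<And>k. k < n \<Longrightarrow> d k \<le> d m" unfolding is_arg_max_linorder by auto
  qed
  define u where "u = col U l"
  define w where "w = map_vec abs u"
  have u: "u \<in> carrier_vec n" using U(1) by (auto simp: u_def)
  then have w: "w \<in> carrier_vec n" by (simp add: w_def)
  have u_coord: "U\<^sup>T *\<^sub>v u = unit_vec n l" unfolding u_def by (rule orth_diag_col[OF assms(1-3)])
  have bilinear: "x \<bullet> (R *\<^sub>v x) = (\<Sum>i<n. \<Sum>j<n. x $ i * R $$ (i,j) * x $ j)"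
    if "x \<in> carrier_vec n" for x
    using that R by (simp add: scalar_prod_def atLeast0LessThan sum_distrib_left mult.assoc)
  have "(\<Sum>k<n. d k * (unit_vec n l $ k)\<^sup>2) = d l"
    using l by (simp add: unit_vec_def if_distrib[of "\<lambda>t. t\<^sup>2"] if_distrib[of "\<lambda>t. _ * t"] cong: if_cong)
  then have "\<bar>d l\<bar> = \<bar>u \<bullet> (R *\<^sub>v u)\<bar>"
    unfolding orth_diag_quadratic_form[OF assms(1,2) u] u_coord by simp
  also have "\<dots> \<le> (\<Sum>i<n. \<Sum>j<n. \<bar>u $ i * R $$ (i,j) * u $ j\<bar>)"
    unfolding bilinear[OF u] by (intro order_trans[OF sum_abs] sum_mono sum_abs)
  also have "\<dots> = w \<bullet> (R *\<^sub>v w)"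
    unfolding bilinear[OF w] using u nonneg by (intro sum.cong refl) (auto simp: w_def abs_mult)
  also have "\<dots> \<le> (\<Sum>k<n. d m * ((U\<^sup>T *\<^sub>v w) $ k)\<^sup>2)"
    unfolding orth_diag_quadratic_form[OF assms(1,2) w] by (intro sum_mono mult_right_mono) (auto simp: max)
  also have "\<dots> = d m * (w \<bullet> w)"
    by (simp add: orth_diag_norm_sq[OF assms(1,2) w] sum_distrib_left)
  also have "w \<bullet> w = u \<bullet> u" using u by (simp add: w_def scalar_prod_def)
  also have "u \<bullet> u = 1"
    using orth_diag_scalar_prod[OF assms(1,2) u u] l by (simp add: u_coord)
  finally show ?thesis using max(1) by auto
qed

section \<open>Spectral invariants in terms of the diagonal\<close>

lemma order_prod_linear_factors:
  fixes a :: "'a::field"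
  shows "order a (\<Prod>e\<leftarrow>es. [:- e, 1:]) = count_list es a"
proof (induction es)
  case (Cons e es)
  have "(\<Prod>e\<leftarrow>es. [:- e, 1:]) \<noteq> 0" by (auto simp: prod_list_zero_iff)
  then have "[:- e, 1:] * (\<Prod>e\<leftarrow>es. [:- e, 1:]) \<noteq> 0" by (intro no_zero_divisors) auto
  then have "order a ([:- e, 1:] * (\<Prod>e\<leftarrow>es. [:- e, 1:])) =
      order a [:- e, 1:] + order a (\<Prod>e\<leftarrow>es. [:- e, 1:])"
    by (rule order_mult)
  moreover have "order a [:- e, 1:] = (if e = a then 1 else 0)"
    by (auto simp: order_linear' )
  ultimately show ?case using Cons.IH by simp
qed simp

text \<open>The list \<open>eigvals\<close> is chosen only up to order. Root multiplicities recover
  it as a multiset from any factorisation, which lets the diagonal \<open>d\<close> stand in for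
  it.\<close>

lemma mset_eq_if_linear_factors_eq:
  fixes es fs :: "'a::field list"
  assumes "(\<Prod>e\<leftarrow>es. [:- e, 1:]) = (\<Prod>e\<leftarrow>fs. [:- e, 1:])"
  shows "mset es = mset fs"
proof (rule multiset_eqI)
  fix a
  have "count_list es a = count_list fs a"
    using assms order_prod_linear_factors[of a es] order_prod_linear_factors[of a fs] by simp
  then show "count (mset es) a = count (mset fs) a" by (simp add: count_mset)
qed

lemma orth_diag_char_poly:
  assumes "orth_diag U d R" "R \<in> carrier_mat n n"
  shows "char_poly R = (\<Prod>k\<leftarrow>[0..<n]. [:- d k, 1:])"
proof -
  note U = orth_diagD[OF assms]
  have "similar_mat R (mat_diag n d)"
    using U assms(2) by (intro similar_matI[of _ _ U "U\<^sup>T" n]) auto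
  then have "char_poly R = char_poly (mat_diag n d)" by (rule char_poly_similar)
  also have "\<dots> = (\<Prod>a\<leftarrow>diag_mat (mat_diag n d). [:- a, 1:])"
    by (rule char_poly_upper_triangular[of _ n]) (auto simp: mat_diag_def upper_triangular_def)
  also have "diag_mat (mat_diag n d) = map d [0..<n]"
    by (auto simp: diag_mat_def mat_diag_def)
  finally show ?thesis by (simp add: o_def)
qed

lemma orth_diag_eigenvalue_iff:
  assumes "orth_diag U d R" "R \<in> carrier_mat n n"
  shows "eigenvalue R x \<longleftrightarrow> x \<in> d ` {..<n}"
  unfolding eigenvalue_root_char_poly[OF assms(2)] orth_diag_char_poly[OF assms]
  by (auto simp: poly_prod_list prod_list_zero_iff)

lemma orth_diag_eigvals:
  assumes "orth_diag U d R" "R \<in> carrier_mat n n"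
  shows "mset (eigvals (map_mat complex_of_real R)) = mset (map (\<lambda>k. complex_of_real (d k)) [0..<n])"
proof (rule mset_eq_if_linear_factors_eq)
  interpret map_poly_comm_ring_hom "of_real :: real \<Rightarrow> complex" ..
  have "char_poly (map_mat complex_of_real R) = map_poly complex_of_real (char_poly R)"
    by (rule of_real_hom.char_poly_hom[OF assms(2)])
  also have "\<dots> = (\<Prod>k\<leftarrow>[0..<n]. [:- complex_of_real (d k), 1:])"
    unfolding orth_diag_char_poly[OF assms]
    by (simp add: hom_prod_list o_def)
  finally show "(\<Prod>e\<leftarrow>eigvals (map_mat complex_of_real R). [:- e, 1:]) =
      (\<Prod>e\<leftarrow>map (\<lambda>k. complex_of_real (d k)) [0..<n]. [:- e, 1:])"
    using eigvals(1)[of "map_mat complex_of_real R" n] assms(2) by (simp add: o_def)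
qed

lemma mat_nullity_eq_count:
  assumes "A \<in> carrier_mat n n"
  shows "mat_nullity A = count_list (eigvals A) 0"
  unfolding mat_nullity_def eigvals(1)[OF assms] by (rule order_prod_linear_factors)

lemma prod_list_filter_nth:
  fixes es :: "'a::comm_monoid_mult list"
  shows "prod_list (filter P es) = (\<Prod>i | i < length es \<and> P (es ! i). es ! i)"
proof (induction es rule: rev_induct)
  case (snoc x xs)
  have "{i. i < length (xs @ [x]) \<and> P ((xs @ [x]) ! i)} =
      {i. i < length xs \<and> P (xs ! i)} \<union> (if P x then {length xs} else {})"
    by (auto simp: nth_append less_Suc_eq)
  moreover have "(\<Prod>i | i < length xs \<and> P (xs ! i). (xs @ [x]) ! i) = prod_list (filter P xs)"
    unfolding snoc.IH by (intro prod.cong) (auto simp: nth_append)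
  ultimately show ?case by (simp add: mult.commute)
qed simp

text \<open>Every other set of \<open>n - \<kappa>\<close> positions meets a zero eigenvalue.\<close>
lemma esym_eigvals_eq_prod_nonzero:
  assumes A: "A \<in> carrier_mat n n"
  shows "esym_eigvals (n - mat_nullity A) A = prod_list (filter (\<lambda>e. e \<noteq> 0) (eigvals A))"
proof -
  define es where "es = eigvals A"
  have len: "length es = n" using eigvals(2)[OF A] by (simp add: es_def)
  define N where "N = {i. i < n \<and> es ! i \<noteq> 0}"
  have "card N = length (filter (\<lambda>e. e \<noteq> 0) es)"
    using len by (simp add: N_def length_filter_conv_card)
  moreover have "count_list es 0 = length (filter (\<lambda>e. \<not> e \<noteq> 0) es)"
    unfolding count_list_eq_length_filter by (intro arg_cong[of _ _ length] filter_cong) auto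
  ultimately have card: "card N = n - mat_nullity A"
    using sum_length_filter_compl[of "\<lambda>e. e \<noteq> 0" es] len mat_nullity_eq_count[OF A]
    by (simp add: es_def)
  define F where "F = {S. S \<subseteq> {..<n} \<and> card S = n - mat_nullity A}"
  have "finite F" unfolding F_def by (rule finite_subset[of _ "Pow {..<n}"]) auto
  moreover have "N \<in> F" using card by (auto simp: F_def N_def)
  moreover have "(\<Prod>i\<in>S. es ! i) = 0" if "S \<in> F - {N}" for S
  proof -
    have S: "S \<subseteq> {..<n}" "card S = card N" "S \<noteq> N" using that card by (auto simp: F_def)
    have "finite N" by (simp add: N_def)
    then have "\<not> S \<subseteq> N" using S card_subset_eq by blast
    then obtain i where "i \<in> S" "es ! i = 0" using S by (auto simp: N_def)
    moreover have "finite S" using S finite_subset by blast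
    ultimately show ?thesis by auto
  qed
  ultimately have "(\<Sum>S\<in>F. \<Prod>i\<in>S. es ! i) = (\<Prod>i\<in>N. es ! i)"
    by (subst sum.remove[of _ N]) (auto intro: sum.neutral)
  then show ?thesis
    using A len unfolding esym_eigvals_def F_def N_def
    by (simp add: prod_list_filter_nth flip: es_def)
qed

section \<open>Frobenius norm, trace and spectral radius\<close>

lemma orth_diag_square:
  assumes "orth_diag U d R" "R \<in> carrier_mat n n"
  shows "orth_diag U (\<lambda>k. (d k)\<^sup>2) (R * R)"
proof -
  note U = orth_diagD[OF assms]
  have UT: "U\<^sup>T \<in> carrier_mat n n" using U(1) by simp
  let ?D = "mat_diag n d"
  note assoc = assoc_mult_mat[of _ n n _ n _ n] mult_carrier_mat[of _ n n _ n] mat_diag_dim U(1) UT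
  have "R * R = (U * ?D * U\<^sup>T) * (U * ?D * U\<^sup>T)" using U(4) by simp
  also have "\<dots> = U * ?D * (U\<^sup>T * U) * ?D * U\<^sup>T" by (simp only: assoc)
  also have "\<dots> = U * (?D * ?D) * U\<^sup>T"
    unfolding U(2) right_mult_one_mat[OF mult_carrier_mat[OF U(1) mat_diag_dim]] by (simp only: assoc)
  also have "?D * ?D = mat_diag n (\<lambda>k. (d k)\<^sup>2)" by (simp add: power2_eq_square)
  finally show ?thesis using U(1-3) assms(2) by (simp add: orth_diag_def)
qed

text \<open>For real symmetric \<open>R\<close> the product with the adjoint is
  \<open>R * R\<close>, with eigenvalues \<open>(d k)\<^sup>2\<close>. These are non-negative, so
  squaring the singular values restores them.\<close>

lemma frobenius_norm_orth_diag:
  assumes "orth_diag U d R" "R \<in> carrier_mat n n" "R\<^sup>T = R"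
  shows "(frobenius_norm (map_mat complex_of_real R))\<^sup>2 = (\<Sum>k<n. (d k)\<^sup>2)"
proof -
  let ?A = "map_mat complex_of_real R"
  have "R $$ (i,j) = R $$ (j,i)" if "i < n" "j < n" for i j
    using that assms(2) arg_cong[OF assms(3), of "\<lambda>M. M $$ (j,i)"] by simp
  then have "mat_adjoint ?A = ?A"
    using assms(2) by (intro eq_matI) (auto simp: mat_adjoint_def mat_of_rows_def)
  moreover have "?A * ?A = map_mat complex_of_real (R * R)"
    by (rule of_real_hom.mat_hom_mult[symmetric, OF assms(2,2)])
  ultimately have "mset (eigvals (mat_adjoint ?A * ?A)) =
      mset (map (\<lambda>k. complex_of_real ((d k)\<^sup>2)) [0..<n])"
    using orth_diag_eigvals[OF orth_diag_square[OF assms(1,2)], of n] assms(2) by simp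
  then have "mset (map (\<lambda>s. s\<^sup>2) (singular_values ?A)) =
      mset (map (\<lambda>k. (sqrt (Re (complex_of_real ((d k)\<^sup>2))))\<^sup>2) [0..<n])"
    by (simp add: singular_values_def image_mset.compositionality o_def
        flip: mset_map) (simp add: image_mset.compositionality o_def)
  then have "sum_list (map (\<lambda>s. s\<^sup>2) (singular_values ?A)) = (\<Sum>k\<leftarrow>[0..<n]. (d k)\<^sup>2)"
    unfolding sum_mset_sum_list[symmetric] by simp
  then show ?thesis
    by (simp add: frobenius_norm_def sum_nonneg interv_sum_list_conv_sum_set_nat atLeast0LessThan)
qed

text \<open>Expanding the diagonal entries of the factorisation weights each \<open>d k\<close> by
  the squared norm of column \<open>k\<close> of \<open>U\<close>, which is
  \<open>1\<close>.\<close>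

lemma mat_trace_orth_diag:
  assumes "orth_diag U d R" "R \<in> carrier_mat n n"
  shows "mat_trace R = (\<Sum>k<n. d k)"
proof -
  note U = orth_diagD[OF assms]
  have "R $$ (i,i) = (\<Sum>k<n. d k * (U $$ (i,k))\<^sup>2)" if "i < n" for i
    by (subst U(4), subst mat_diag_mult_right[OF U(1)])
      (use that U(1) in \<open>simp add: scalar_prod_def atLeast0LessThan power2_eq_square mult_ac\<close>)
  then have "mat_trace R = (\<Sum>i<n. \<Sum>k<n. d k * (U $$ (i,k))\<^sup>2)"
    using assms(2) by (simp add: mat_trace_def)
  also have "\<dots> = (\<Sum>k<n. d k * (\<Sum>i<n. (U $$ (i,k))\<^sup>2))"
    unfolding sum_distrib_left by (rule sum.swap)
  also have "\<dots> = (\<Sum>k<n. d k)"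
  proof (intro sum.cong refl)
    fix k assume "k \<in> {..<n}"
    then have "(\<Sum>i<n. (U $$ (i,k))\<^sup>2) = (U\<^sup>T * U) $$ (k,k)"
      using U(1) by (simp add: scalar_prod_def atLeast0LessThan power2_eq_square)
    then show "d k * (\<Sum>i<n. (U $$ (i,k))\<^sup>2) = d k" using U(2) \<open>k \<in> _\<close> by simp
  qed
  finally show ?thesis .
qed

text \<open>An index carrying the maximum of \<open>d\<close> dominates all moduli by the
  Perron-Frobenius bound, so it also realises the spectral radius. Naming the index allows a single
  copy of this eigenvalue to be set aside when it is multiple.\<close>

lemma symmetric_nonneg_largest_eigenvalue:
  assumes "orth_diag U d R" and R: "R \<in> carrier_mat n n" and n: "0 < n"
    and nonneg: "\<And>i j. i < n \<Longrightarrow> j < n \<Longrightarrow> 0 \<le> R $$ (i,j)"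
  shows "\<exists>m<n. d m = largest_eigenvalue R \<and> d m = spectral_radius (map_mat complex_of_real R) \<and>
    (\<forall>k<n. \<bar>d k\<bar> \<le> d m)"
proof -
  let ?A = "map_mat complex_of_real R"
  have A: "?A \<in> carrier_mat n n" using R by simp
  have "Max (d ` {..<n}) \<in> d ` {..<n}" using n by (intro Max_in) auto
  then obtain m where m: "m < n" "d m = Max (d ` {..<n})" by auto
  have bound: "\<bar>d k\<bar> \<le> d m" if "k < n" for k
  proof -
    obtain l where "l < n" "\<bar>d k\<bar> \<le> d l"
      using nonneg_symmetric_max_eigenvalue[OF assms(1) R \<open>k < n\<close>] nonneg by blast
    moreover have "d l \<le> d m" unfolding m(2) using \<open>l < n\<close> by (intro Max_ge) auto
    ultimately show ?thesis by linarith
  qed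
  have "spectrum ?A = set (eigvals ?A)"
    unfolding spectrum_root_char_poly[OF A] eigvals(1)[OF A]
    by (auto simp: poly_prod_list prod_list_zero_iff)
  also have "\<dots> = complex_of_real ` d ` {..<n}"
    using arg_cong[OF orth_diag_eigvals[OF assms(1) R], of set_mset] by auto
  finally have "spectral_radius ?A = Max (abs ` d ` {..<n})"
    by (simp add: spectral_radius_def image_image)
  also have "\<dots> = d m"
  proof (rule Max_eqI)
    show "d m \<in> abs ` d ` {..<n}" using m(1) bound[OF m(1)] by (force simp: image_iff)
  qed (use bound in auto)
  finally show ?thesis
    using m bound by (auto simp: largest_eigenvalue_def orth_diag_eigenvalue_iff[OF assms(1) R])
qed

section \<open>Lists of real eigenvalues\<close>

text \<open>Termwise from \<open>ln t \<le> t - 1\<close> for positive \<open>t\<close>, with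
  equality only at \<open>t = 1\<close>.\<close>

lemma sum_sub_ln_nonneg:
  fixes ys :: "real list"
  assumes "0 \<notin> set ys"
  shows "0 \<le> (\<Sum>y\<leftarrow>ys. \<bar>y\<bar> - 1 - ln \<bar>y\<bar>)"
    and "(\<Sum>y\<leftarrow>ys. \<bar>y\<bar> - 1 - ln \<bar>y\<bar>) = 0 \<longleftrightarrow> (\<forall>y\<in>set ys. \<bar>y\<bar> = 1)"
proof -
  have nonneg: "0 \<le> \<bar>y\<bar> - 1 - ln \<bar>y\<bar>" if "y \<in> set ys" for y
  proof -
    have "y \<noteq> 0" using that assms by auto
    then show ?thesis using ln_le_minus_one[of "\<bar>y\<bar>"] by simp
  qed
  show "0 \<le> (\<Sum>y\<leftarrow>ys. \<bar>y\<bar> - 1 - ln \<bar>y\<bar>)"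
    by (rule sum_list_nonneg) (use nonneg in auto)
  have "\<bar>y\<bar> - 1 - ln \<bar>y\<bar> = 0 \<longleftrightarrow> \<bar>y\<bar> = 1" if "y \<in> set ys" for y
  proof -
    have "y \<noteq> 0" using that assms by auto
    then show ?thesis using ln_eq_minus_one[of "\<bar>y\<bar>"] by auto
  qed
  moreover have "(\<Sum>y\<leftarrow>ys. \<bar>y\<bar> - 1 - ln \<bar>y\<bar>) = 0 \<longleftrightarrow>
      (\<forall>t\<in>set (map (\<lambda>y. \<bar>y\<bar> - 1 - ln \<bar>y\<bar>) ys). t = 0)"
    by (rule sum_list_nonneg_eq_0_iff) (use nonneg in auto)
  ultimately show "(\<Sum>y\<leftarrow>ys. \<bar>y\<bar> - 1 - ln \<bar>y\<bar>) = 0 \<longleftrightarrow> (\<forall>y\<in>set ys. \<bar>y\<bar> = 1)"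
    by auto
qed

lemma sum_sub_ln:
  fixes ys :: "real list"
  assumes "0 \<notin> set ys"
  shows "(\<Sum>y\<leftarrow>ys. \<bar>y\<bar> - 1 - ln \<bar>y\<bar>) =
    (\<Sum>y\<leftarrow>ys. \<bar>y\<bar>) - real (length ys) - ln \<bar>prod_list ys\<bar>"
  using assms
proof (induction ys)
  case (Cons y ys)
  then have "prod_list ys \<noteq> 0" by (auto simp: prod_list_zero_iff)
  then have "ln \<bar>y * prod_list ys\<bar> = ln \<bar>y\<bar> + ln \<bar>prod_list ys\<bar>"
    using Cons.prems by (simp add: abs_mult ln_mult)
  then show ?case using Cons by simp
qed simp

lemma remove1_map_inj:
  assumes "inj f"
  shows "remove1 (f x) (map f xs) = map f (remove1 x xs)"
  using assms by (induction xs) (auto simp: inj_eq)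

text \<open>Length and sum give two linear equations for the numbers of \<open>1\<close> and
  \<open>- 1\<close>; the sum of squares expresses the length through the Frobenius norm.\<close>

lemma sign_list_counts:
  fixes ys :: "real list"
  assumes "\<forall>y\<in>set ys. \<bar>y\<bar> = 1"
  shows "real (length ys) = real (count_list ys (- 1)) + real (count_list ys 1)"
    and "sum_list ys = real (count_list ys 1) - real (count_list ys (- 1))"
    and "(\<Sum>y\<leftarrow>ys. y\<^sup>2) = real (length ys)"
  using assms by (induction ys) (auto simp: abs_if split: if_splits)

section \<open>Splitting off one copy of the spectral radius\<close>

lemma count_list_filter:
  assumes "P x"
  shows "count_list (filter P xs) x = count_list xs x"
  using assms by (induction xs) auto

lemma count_list_remove1:
  assumes "x \<noteq> y"
  shows "count_list (remove1 y xs) x = count_list xs x"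
  using assms by (induction xs) auto

lemma count_list_map_inj:
  assumes "inj f"
  shows "count_list (map f xs) (f x) = count_list xs x"
  using assms by (induction xs) (auto simp: inj_eq)

lemma mset_nonzero_remove1:
  fixes xs :: "real list"
  assumes "\<rho> \<in> set xs" "\<rho> \<noteq> 0"
  shows "mset (filter (\<lambda>x. x \<noteq> 0) xs) = mset (\<rho> # filter (\<lambda>x. x \<noteq> 0) (remove1 \<rho> xs))"
proof -
  have "mset xs = add_mset \<rho> (mset (remove1 \<rho> xs))" using assms(1) by simp
  then have "filter_mset (\<lambda>x. x \<noteq> 0) (mset xs) = add_mset \<rho> (filter_mset (\<lambda>x. x \<noteq> 0) (mset (remove1 \<rho> xs)))"
    using assms(2) by (simp only: filter_mset_add_mset) simp
  then show ?thesis by (simp add: mset_filter)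
qed

lemma length_nonzero_remove1:
  fixes xs :: "real list"
  assumes "\<rho> \<in> set xs" "\<rho> \<noteq> 0"
  shows "length xs = count_list xs 0 + 1 + length (filter (\<lambda>x. x \<noteq> 0) (remove1 \<rho> xs))"
proof -
  have "length (filter (\<lambda>x. x \<noteq> 0) xs) = 1 + length (filter (\<lambda>x. x \<noteq> 0) (remove1 \<rho> xs))"
    using mset_eq_length[OF mset_nonzero_remove1[OF assms]] by simp
  moreover have "count_list xs 0 = length (filter (\<lambda>x. \<not> x \<noteq> 0) xs)"
    unfolding count_list_eq_length_filter by (intro arg_cong[of _ _ length] filter_cong) auto
  ultimately show ?thesis using sum_length_filter_compl[of "\<lambda>x. x \<noteq> 0" xs] by simp
qed

lemma sum_list_nonzero_remove1:
  fixes xs :: "real list" and f :: "real \<Rightarrow> real"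
  assumes "\<rho> \<in> set xs" "\<rho> \<noteq> 0" "f 0 = 0"
  shows "(\<Sum>x\<leftarrow>xs. f x) = f \<rho> + (\<Sum>y\<leftarrow>filter (\<lambda>x. x \<noteq> 0) (remove1 \<rho> xs). f y)"
proof -
  have "(\<Sum>x\<leftarrow>xs. f x) = (\<Sum>x\<leftarrow>filter (\<lambda>x. x \<noteq> 0) xs. f x)"
    by (rule sum_list_map_filter[symmetric]) (use assms(3) in auto)
  also have "\<dots> = sum_mset (image_mset f (mset (filter (\<lambda>x. x \<noteq> 0) xs)))"
    by (simp flip: sum_mset_sum_list)
  also have "\<dots> = f \<rho> + (\<Sum>y\<leftarrow>filter (\<lambda>x. x \<noteq> 0) (remove1 \<rho> xs). f y)"
    unfolding mset_nonzero_remove1[OF assms(1,2)] by (simp flip: sum_mset_sum_list)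
  finally show ?thesis .
qed

text \<open>The contribution \<open>\<rho>\<close> cancels on both sides, \<open>ln \<rho>\<close>
  turns the product of all nonzero eigenvalues into the product of \<open>ys\<close>, and order
  minus nullity minus one is the length of \<open>ys\<close>. The remainder splits into one term per
  entry of \<open>ys\<close>.\<close>

lemma energy_gap:
  fixes xs :: "real list"
  assumes "\<rho> \<in> set xs" "0 < \<rho>"
  defines "ys \<equiv> filter (\<lambda>x. x \<noteq> 0) (remove1 \<rho> xs)"
  shows "(\<Sum>x\<leftarrow>xs. \<bar>x\<bar>) - (\<rho> + real (length xs) - real (count_list xs 0) - 1
      + ln \<bar>prod_list (filter (\<lambda>x. x \<noteq> 0) xs)\<bar> - ln \<rho>) = (\<Sum>y\<leftarrow>ys. \<bar>y\<bar> - 1 - ln \<bar>y\<bar>)"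
proof -
  have nz: "0 \<notin> set ys" by (simp add: ys_def)
  have "prod_list (filter (\<lambda>x. x \<noteq> 0) xs) = \<rho> * prod_list ys"
    using arg_cong[OF mset_nonzero_remove1[of \<rho> xs], of prod_mset] assms
    by (simp only: prod_mset_prod_list) simp
  moreover have "prod_list ys \<noteq> 0" using nz by (auto simp: prod_list_zero_iff)
  ultimately have "ln \<bar>prod_list (filter (\<lambda>x. x \<noteq> 0) xs)\<bar> = ln \<rho> + ln \<bar>prod_list ys\<bar>"
    using assms by (simp add: abs_mult ln_mult)
  moreover have "(\<Sum>x\<leftarrow>xs. \<bar>x\<bar>) = \<rho> + (\<Sum>y\<leftarrow>ys. \<bar>y\<bar>)"
    using sum_list_nonzero_remove1[of \<rho> xs abs] assms by simp
  moreover have "length xs = count_list xs 0 + 1 + length ys"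
    using length_nonzero_remove1[of \<rho> xs] assms by simp
  ultimately show ?thesis by (simp add: sum_sub_ln[OF nz])
qed

section \<open>Submatrices with two large eigenvalues\<close>

lemma submatrix_index_map:
  assumes R: "R \<in> carrier_mat n n'" and S: "submatrix R I J \<in> carrier_mat r c"
  shows "\<exists>p q. (\<forall>i<r. p i < n) \<and> (\<forall>j<c. q j < n') \<and> inj_on p {..<r} \<and> inj_on q {..<c} \<and>
    (\<forall>i<r. \<forall>j<c. submatrix R I J $$ (i,j) = R $$ (p i, q j))"
proof (rule exI[of _ "pick I"], rule exI[of _ "pick J"], intro conjI allI impI)
  have r: "card {i. i < n \<and> i \<in> I} = r" and c: "card {j. j < n' \<and> j \<in> J} = c"
    using S R dim_submatrix[of R I J] by auto
  \<comment> \<open>Index sets may be infinite or reach beyond the matrix, so injectivity of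
    \<open>pick\<close> is claimed only below the number of indices in range.\<close>
  have inj: "inj_on (pick K) {..<card {i. i < N \<and> i \<in> K}}" for K N
  proof (rule strict_mono_on_imp_inj_on, rule strict_mono_onI)
    fix i j assume "i < j" and j: "j \<in> {..<card {i. i < N \<and> i \<in> K}}"
    show "pick K i < pick K j"
    proof (cases "finite K")
      case True
      have "card {i. i < N \<and> i \<in> K} \<le> card K" by (rule card_mono) (use True in auto)
      then show ?thesis using \<open>i < j\<close> j by (intro pick_mono) auto
    qed (use \<open>i < j\<close> pick_mono_inf in auto)
  qed
  show "inj_on (pick I) {..<r}" "inj_on (pick J) {..<c}"
    using inj[of I n] inj[of J n'] r c by auto
  show "pick I i < n" if "i < r" for i using pick_le[of i n I] that r by simp
  show "pick J j < n'" if "j < c" for j using pick_le[of j n' J] that c by simp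
  show "submatrix R I J $$ (i,j) = R $$ (pick I i, pick J j)" if "i < r" "j < c" for i j
    using that r c R by (simp add: submatrix_index)
qed

text \<open>If only one eigenvalue exceeds \<open>1\<close> in modulus, then \<open>R\<close> is a contraction on a hyperplane. A
  symmetric submatrix with two eigenvalues exceeding \<open>1\<close> in modulus is strictly expanding on a plane,
  which meets the hyperplane nontrivially, although the submatrix need not be principal.\<close>
lemma submatrix_single_large_eigenvalue:
  assumes R: "orth_diag U d R" "R \<in> carrier_mat n n"
    and m: "m < n" "\<And>k. k < n \<Longrightarrow> k \<noteq> m \<Longrightarrow> \<bar>d k\<bar> \<le> 1"
    and S: "orth_diag V s S" "S \<in> carrier_mat r r"
    and p: "\<And>i. i < r \<Longrightarrow> p i < n" "inj_on p {..<r}"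
    and q: "\<And>i. i < r \<Longrightarrow> q i < n" "inj_on q {..<r}"
    and sub: "\<And>i j. i < r \<Longrightarrow> j < r \<Longrightarrow> S $$ (i,j) = R $$ (p i, q j)"
    and l: "l < r" "l' < r" "l \<noteq> l'"
  shows "\<bar>s l\<bar> \<le> 1 \<or> \<bar>s l'\<bar> \<le> 1"
proof (rule ccontr)
  assume "\<not> ?thesis"
  then have large: "1 < (s l)\<^sup>2" "1 < (s l')\<^sup>2"
    using one_less_power[of "\<bar>s l\<bar>" 2] one_less_power[of "\<bar>s l'\<bar>" 2] by simp_all
  note U = orth_diagD[OF R] and V = orth_diagD[OF S]
  \<comment> \<open>The coordinate along the exceptional eigenvector \<open>col U m\<close> of a
    vector supported on the columns \<open>q\<close>.\<close>
  define h where "h x = (\<Sum>j<r. U $$ (q j, m) * x $ j)" for x :: "real vec"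
  \<comment> \<open>Coefficients of a nonzero vector in the plane of the two eigenvectors on which
    \<open>h\<close> vanishes: a single linear condition cannot exclude a whole plane.\<close>
  define \<alpha> \<beta> where "\<alpha> = (if h (col V l) = 0 then 1 else h (col V l'))"
    and "\<beta> = (if h (col V l) = 0 then 0 else - h (col V l))"
  have \<alpha>\<beta>: "\<alpha> * h (col V l) + \<beta> * h (col V l') = 0" "\<alpha> \<noteq> 0 \<or> \<beta> \<noteq> 0"
    by (auto simp: \<alpha>_def \<beta>_def)
  define z where "z = \<alpha> \<cdot>\<^sub>v col V l + \<beta> \<cdot>\<^sub>v col V l'"
  have cols: "col V l \<in> carrier_vec r" "col V l' \<in> carrier_vec r" using V(1) by auto
  then have z: "z \<in> carrier_vec r" by (simp add: z_def)
  have hz: "h z = 0"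
    using \<alpha>\<beta>(1) cols V(1) l
    by (simp add: h_def z_def sum_distrib_left sum.distrib algebra_simps)
  have z_coord: "V\<^sup>T *\<^sub>v z = \<alpha> \<cdot>\<^sub>v unit_vec r l + \<beta> \<cdot>\<^sub>v unit_vec r l'"
    unfolding z_def using V(1) cols l
    by (simp add: mult_add_distrib_mat_vec[of _ r r] mult_mat_vec[of _ r r]
        orth_diag_col[OF S l(1)] orth_diag_col[OF S l(2)])
  have coord_sum: "(\<Sum>k<r. f k * ((V\<^sup>T *\<^sub>v z) $ k)\<^sup>2) = f l * \<alpha>\<^sup>2 + f l' * \<beta>\<^sup>2" for f :: "nat \<Rightarrow> real"
  proof -
    have "f k * ((V\<^sup>T *\<^sub>v z) $ k)\<^sup>2 = (if k = l then f l * \<alpha>\<^sup>2 else 0) + (if k = l' then f l' * \<beta>\<^sup>2 else 0)"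
      if "k < r" for k using that l unfolding z_coord by auto
    then show ?thesis using l by (simp add: sum.distrib)
  qed
  have "z \<bullet> z = \<alpha>\<^sup>2 + \<beta>\<^sup>2"
    using coord_sum[of "\<lambda>_. 1"] orth_diag_norm_sq[OF S z] by simp
  also have "\<dots> < (s l)\<^sup>2 * \<alpha>\<^sup>2 + (s l')\<^sup>2 * \<beta>\<^sup>2"
  proof (cases "\<alpha> = 0")
    case True
    then show ?thesis using \<alpha>\<beta>(2) large by simp
  next
    case False
    then have "\<alpha>\<^sup>2 < (s l)\<^sup>2 * \<alpha>\<^sup>2" using large by simp
    moreover have "\<beta>\<^sup>2 \<le> (s l')\<^sup>2 * \<beta>\<^sup>2"
      using mult_right_mono[of 1 "(s l')\<^sup>2" "\<beta>\<^sup>2"] large by simp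
    ultimately show ?thesis by linarith
  qed
  also have "\<dots> = (S *\<^sub>v z) \<bullet> (S *\<^sub>v z)"
    using coord_sum[of "\<lambda>k. (s k)\<^sup>2"] orth_diag_mult_vec_norm_sq[OF S z] by simp
  finally have expand: "z \<bullet> z < (S *\<^sub>v z) \<bullet> (S *\<^sub>v z)" .
  \<comment> \<open>Zero padding places \<open>z\<close> at the columns \<open>q\<close>, so the
    rows \<open>p\<close> of \<open>R *\<^sub>v x\<close> reproduce
    \<open>S *\<^sub>v z\<close>.\<close>
  define x where "x = vec n (\<lambda>j. if j \<in> q ` {..<r} then z $ the_inv_into {..<r} q j else 0)"
  have x: "x \<in> carrier_vec n" by (simp add: x_def)
  have xq: "x $ q j = z $ j" if "j < r" for j
    using that q by (simp add: x_def the_inv_into_f_f)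
  have extend: "(\<Sum>j<n. f j * x $ j) = (\<Sum>j<r. f (q j) * z $ j)" for f
  proof -
    have "(\<Sum>j<n. f j * x $ j) = (\<Sum>j\<in>q ` {..<r}. f j * x $ j)"
      using q(1) by (intro sum.mono_neutral_right) (auto simp: x_def)
    also have "\<dots> = (\<Sum>j<r. f (q j) * z $ j)"
      using q by (simp add: sum.reindex xq)
    finally show ?thesis .
  qed
  have x_norm: "x \<bullet> x = z \<bullet> z"
    using extend[of "\<lambda>j. x $ j"] x z by (simp add: scalar_prod_def atLeast0LessThan xq)
  have "(U\<^sup>T *\<^sub>v x) $ m = h z"
    using extend[of "\<lambda>j. U $$ (j,m)"] U(1) x m(1)
    by (simp add: scalar_prod_def atLeast0LessThan h_def)
  then have xm: "(U\<^sup>T *\<^sub>v x) $ m = 0" using hz by simp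
  have Rx: "(R *\<^sub>v x) $ p i = (S *\<^sub>v z) $ i" if "i < r" for i
    using extend[of "\<lambda>j. R $$ (p i, j)"] R(2) S(2) x z that p(1)[OF that]
    by (simp add: scalar_prod_def atLeast0LessThan sub)
  have "(S *\<^sub>v z) \<bullet> (S *\<^sub>v z) = (\<Sum>i<r. ((R *\<^sub>v x) $ p i)\<^sup>2)"
    using S(2) by (simp add: scalar_prod_def atLeast0LessThan power2_eq_square Rx)
  also have "\<dots> = (\<Sum>i\<in>p ` {..<r}. ((R *\<^sub>v x) $ i)\<^sup>2)"
    using p(2) by (simp add: sum.reindex)
  \<comment> \<open>Rows outside the range of \<open>p\<close> only add squares. Nothing here
    relates \<open>p\<close> to \<open>q\<close>, hence non-principal submatrices are
    covered.\<close>
  also have "\<dots> \<le> (\<Sum>i<n. ((R *\<^sub>v x) $ i)\<^sup>2)"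
    using p(1) by (intro sum_mono2) auto
  also have "\<dots> = (R *\<^sub>v x) \<bullet> (R *\<^sub>v x)"
    using R(2) by (simp add: scalar_prod_def atLeast0LessThan power2_eq_square)
  also have "\<dots> = (\<Sum>k<n. (d k)\<^sup>2 * ((U\<^sup>T *\<^sub>v x) $ k)\<^sup>2)"
    by (rule orth_diag_mult_vec_norm_sq[OF R x])
  also have "\<dots> \<le> (\<Sum>k<n. ((U\<^sup>T *\<^sub>v x) $ k)\<^sup>2)"
  proof (intro sum_mono)
    \<comment> \<open>The coordinate at \<open>m\<close> is zero by the choice of \<open>z\<close>;
      all others are scaled by factors of modulus at most \<open>1\<close>.\<close>
    fix k assume "k \<in> {..<n}"
    then show "(d k)\<^sup>2 * ((U\<^sup>T *\<^sub>v x) $ k)\<^sup>2 \<le> ((U\<^sup>T *\<^sub>v x) $ k)\<^sup>2"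
      using m(2)[of k] xm by (cases "k = m") (auto intro: mult_left_le_one_le simp: abs_square_le_1)
  qed
  also have "\<dots> = z \<bullet> z" using orth_diag_norm_sq[OF R x] x_norm by simp
  finally show False using expand by simp
qed

text \<open>A Rayleigh quotient below \<open>- 1\<close> forces an eigenvalue below
  \<open>- 1\<close>. Non-negativity then supplies a positive eigenvalue of at least that modulus,
  and the signs keep the two indices apart.\<close>

lemma symmetric_nonneg_two_large_eigenvalues:
  assumes S: "orth_diag V s S" "S \<in> carrier_mat r r"
    and nonneg: "\<And>i j. i < r \<Longrightarrow> j < r \<Longrightarrow> 0 \<le> S $$ (i,j)"
    and x: "x \<in> carrier_vec r" "x \<bullet> (S *\<^sub>v x) < - (x \<bullet> x)"
  shows "\<exists>l<r. \<exists>l'<r. l \<noteq> l' \<and> 1 < \<bar>s l\<bar> \<and> 1 < \<bar>s l'\<bar>"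
proof -
  have "\<exists>l<r. s l < - 1"
  proof (rule ccontr)
    assume "\<not> ?thesis"
    then have "- 1 \<le> s k" if "k < r" for k using that not_less by blast
    then have "(\<Sum>k<r. - 1 * ((V\<^sup>T *\<^sub>v x) $ k)\<^sup>2) \<le> (\<Sum>k<r. s k * ((V\<^sup>T *\<^sub>v x) $ k)\<^sup>2)"
      by (intro sum_mono mult_right_mono) auto
    then show False
      using x(2) unfolding orth_diag_quadratic_form[OF S x(1)] orth_diag_norm_sq[OF S x(1)]
      by (simp add: sum_negf)
  qed
  then obtain l where l: "l < r" "s l < - 1" by blast
  then obtain l' where "l' < r" "\<bar>s l\<bar> \<le> s l'"
    using nonneg_symmetric_max_eigenvalue[OF S l(1)] nonneg by blast
  with l show ?thesis by (intro exI[of _ l] conjI exI[of _ l']) auto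
qed

text \<open>A violating vector would give \<open>S\<close> two eigenvalues of modulus above
  \<open>1\<close>, since \<open>S\<close> inherits non-negative entries from \<open>R\<close>. At
  most one is possible when all but one of the eigenvalues of \<open>R\<close> have modulus at most
  \<open>1\<close>.\<close>

lemma submatrix_rayleigh_ge:
  assumes R: "orth_diag U d R" "R \<in> carrier_mat n n"
    and nonneg: "\<And>i j. i < n \<Longrightarrow> j < n \<Longrightarrow> 0 \<le> R $$ (i,j)"
    and m: "m < n" "\<And>k. k < n \<Longrightarrow> k \<noteq> m \<Longrightarrow> \<bar>d k\<bar> \<le> 1"
    and sub: "submatrix R I J = S" and S: "S \<in> carrier_mat r r" "S\<^sup>T = S"
    and x: "x \<in> carrier_vec r"
  shows "- (x \<bullet> x) \<le> x \<bullet> (S *\<^sub>v x)"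
proof (rule ccontr)
  assume "\<not> ?thesis"
  then have neg: "x \<bullet> (S *\<^sub>v x) < - (x \<bullet> x)" by simp
  have "submatrix R I J \<in> carrier_mat r r" using sub S(1) by simp
  from submatrix_index_map[OF R(2) this] obtain p q
    where p: "\<And>i. i < r \<Longrightarrow> p i < n" "inj_on p {..<r}"
      and q: "\<And>i. i < r \<Longrightarrow> q i < n" "inj_on q {..<r}"
      and index: "\<And>i j. i < r \<Longrightarrow> j < r \<Longrightarrow> S $$ (i,j) = R $$ (p i, q j)"
    unfolding sub by blast
  obtain V s where V: "orth_diag V s S" using orth_diag_exists[OF S] by blast
  obtain l l' where "l < r" "l' < r" "l \<noteq> l'" "1 < \<bar>s l\<bar>" "1 < \<bar>s l'\<bar>"
    using symmetric_nonneg_two_large_eigenvalues[OF V S(1) _ x neg] index nonneg p(1) q(1) by auto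
  then show False
    using submatrix_single_large_eigenvalue[OF R m V S(1) p q index, of l l'] by auto
qed

lemma hollow_symmetric_3_quadratic_form:
  fixes a b c \<alpha> \<beta> \<gamma> :: real
  defines "S \<equiv> mat_of_rows_list 3 [[0, a, c], [a, 0, b], [c, b, 0]]"
    and "x \<equiv> vec_of_list [\<alpha>, \<beta>, \<gamma>]"
  shows "S \<in> carrier_mat 3 3" "S\<^sup>T = S" "x \<in> carrier_vec 3"
    "x \<bullet> (S *\<^sub>v x) = 2 * (a * \<alpha> * \<beta> + b * \<beta> * \<gamma> + c * \<alpha> * \<gamma>)"
    "x \<bullet> x = \<alpha>\<^sup>2 + \<beta>\<^sup>2 + \<gamma>\<^sup>2"
proof -
  have S_mat: "S = mat 3 3 (\<lambda>(i,j). [[0, a, c], [a, 0, b], [c, b, 0]] ! i ! j)"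
    unfolding S_def mat_of_rows_list_def by (simp add: numeral_3_eq_3)
  have less_3: "i = 0 \<or> i = 1 \<or> i = 2" if "i < 3" for i :: nat using that by auto
  have sum_3: "sum f {0..<3} = f 0 + f 1 + f 2" for f :: "nat \<Rightarrow> real"
    by (simp add: numeral_eq_Suc)
  show S: "S \<in> carrier_mat 3 3" unfolding S_mat by simp
  have dim_x: "dim_vec x = 3" by (simp add: x_def)
  then show x: "x \<in> carrier_vec 3" by (rule carrier_vecI)
  have x_index: "x $ 0 = \<alpha>" "x $ 1 = \<beta>" "x $ 2 = \<gamma>"
    unfolding x_def vec_of_list_index by simp_all
  show "S\<^sup>T = S" by (rule eq_matI) (auto simp: S_mat dest!: less_3)
  have "S *\<^sub>v x = vec 3 (\<lambda>i. \<Sum>j = 0..<3. S $$ (i,j) * x $ j)"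
    using S dim_x by (intro eq_vecI) (auto simp: scalar_prod_def)
  then have "x \<bullet> (S *\<^sub>v x) = (\<Sum>i = 0..<3. x $ i * (\<Sum>j = 0..<3. S $$ (i,j) * x $ j))"
    by (simp add: scalar_prod_def)
  also have "\<dots> = 2 * (a * \<alpha> * \<beta> + b * \<beta> * \<gamma> + c * \<alpha> * \<gamma>)"
    unfolding sum_3 x_index by (simp add: S_mat algebra_simps)
  finally show "x \<bullet> (S *\<^sub>v x) = 2 * (a * \<alpha> * \<beta> + b * \<beta> * \<gamma> + c * \<alpha> * \<gamma>)" .
  have "x \<bullet> x = (\<Sum>i = 0..<3. x $ i * x $ i)" unfolding scalar_prod_def dim_x ..
  then show "x \<bullet> x = \<alpha>\<^sup>2 + \<beta>\<^sup>2 + \<gamma>\<^sup>2"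
    unfolding sum_3 x_index by (simp add: power2_eq_square)
qed

section \<open>Energy bound\<close>

text \<open>The zero matrix is excluded because its spectral radius \<open>0\<close> has no
  logarithm. Only one copy of the largest eigenvalue is exempt, hence \<open>remove1\<close>. The
  counting formulas concern the equality case. The test quotient divides by the squared norm, as a
  Rayleigh quotient does: with the norm itself, rescaling \<open>(1, - 1, 0)\<close> would satisfy
  the condition for the triangle with \<open>a = b = c = 1\<close>, whose eigenvalues
  \<open>2, - 1, - 1\<close> give equality.\<close>

theorem theorem3:
  fixes R :: "real mat" and A :: "complex mat" and n \<kappa> :: nat and \<rho> B :: real
  assumes "R \<in> carrier_mat n n"
    and "transpose_mat R = R"
    and "\<forall>i<n. \<forall>j<n. 0 \<le> R $$ (i, j)"
    and "R \<noteq> 0\<^sub>m n n"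
    and "A = map_mat complex_of_real R"
    and "\<rho> = spectral_radius A"
    and "mat_nullity A = \<kappa>"
    and "B = \<rho> + real n - real \<kappa> - 1 + ln (cmod (esym_eigvals (n - \<kappa>) A)) - ln \<rho>"
  shows "(mat_energy A \<ge> B) \<and>
    (mat_energy A = B \<longleftrightarrow>
      (\<forall>e \<in> set (remove1 (complex_of_real (largest_eigenvalue R)) (eigvals A)).
         e \<noteq> 0 \<longrightarrow> cmod e = 1)) \<and>
    (mat_energy A = B \<and> largest_eigenvalue R > 1 \<and> mat_trace R = 0 \<longrightarrow>
      real (count_list (eigvals A) (- 1)) = ((frobenius_norm A)\<^sup>2 - \<rho>\<^sup>2 + \<rho>) / 2 \<and>
      real (count_list (eigvals A) 1) = ((frobenius_norm A)\<^sup>2 - \<rho>\<^sup>2 - \<rho>) / 2 \<and>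
      real \<kappa> = real n - 1 + \<rho>\<^sup>2 - (frobenius_norm A)\<^sup>2) \<and>
    ((\<exists>I J a b. submatrix R I J = mat_of_rows_list 3 [[0, a, 0], [a, 0, b], [0, b, 0]] \<and>
            sqrt (a\<^sup>2 + b\<^sup>2) > 1) \<or>
         (\<exists>I J a b c. submatrix R I J = mat_of_rows_list 3 [[0, a, c], [a, 0, b], [c, b, 0]] \<and>
            (\<exists>\<alpha> \<beta> \<gamma> :: real.
               2 * (a * \<alpha> * \<beta> + b * \<beta> * \<gamma> + c * \<alpha> * \<gamma>) / (\<alpha>\<^sup>2 + \<beta>\<^sup>2 + \<gamma>\<^sup>2) < - 1)) \<longrightarrow>
      mat_energy A > B)"
proof -
  note R = assms(1) and R_sym = assms(2) and A_def = assms(5)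
  have nonneg: "\<And>i j. i < n \<Longrightarrow> j < n \<Longrightarrow> 0 \<le> R $$ (i,j)" using assms(3) by blast
  have A: "A \<in> carrier_mat n n" using R by (simp add: A_def)
  have n: "0 < n"
  proof (rule ccontr)
    assume "\<not> 0 < n"
    then have "R = 0\<^sub>m n n" using R by (intro eq_matI) auto
    with assms(4) show False ..
  qed
  obtain U d where U: "orth_diag U d R" using orth_diag_exists[OF R R_sym] by blast
  obtain m where m: "m < n" "d m = \<rho>" and largest: "largest_eigenvalue R = \<rho>"
    and bound: "\<And>k. k < n \<Longrightarrow> \<bar>d k\<bar> \<le> \<rho>"
    using symmetric_nonneg_largest_eigenvalue[OF U R n] nonneg assms(5,6) by auto
  \<comment> \<open>Otherwise the bound on the moduli makes every eigenvalue zero, and a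
    diagonalisable matrix with zero diagonal form is zero.\<close>
  have \<rho>: "0 < \<rho>"
  proof (rule ccontr)
    assume "\<not> 0 < \<rho>"
    then have "d k = 0" if "k < n" for k using bound[OF that] by linarith
    then have "mat_diag n d = 0\<^sub>m n n" by (intro eq_matI) (auto simp: mat_diag_def)
    then have "R = U * 0\<^sub>m n n * U\<^sup>T" using orth_diagD(4)[OF U R] by metis
    also have "\<dots> = 0\<^sub>m n n" using orth_diagD(1)[OF U R] by simp
    finally show False using assms(4) by blast
  qed
  \<comment> \<open>All eigenvalues are real, so \<open>Re\<close> loses nothing and the remaining
    argument concerns a list of reals.\<close>
  define xs where "xs = map Re (eigvals A)"
  have mset_eigvals: "mset (eigvals A) = mset (map (\<lambda>k. complex_of_real (d k)) [0..<n])"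
    unfolding A_def by (rule orth_diag_eigvals[OF U R])
  have mset_xs: "mset xs = mset (map d [0..<n])"
    unfolding xs_def mset_map mset_eigvals by (simp add: image_mset.compositionality o_def)
  have eigvals_xs: "eigvals A = map complex_of_real xs"
  proof -
    have "complex_of_real (Re e) = e" if "e \<in> set (eigvals A)" for e
      using arg_cong[OF mset_eigvals, of set_mset] that by auto
    then show ?thesis by (simp add: xs_def map_idI)
  qed
  have len: "length xs = n" using eigvals(2)[OF A] by (simp add: xs_def)
  have \<rho>_mem: "\<rho> \<in> set xs" using arg_cong[OF mset_xs, of set_mset] m by auto
  have sum_xs: "(\<Sum>x\<leftarrow>xs. f x) = (\<Sum>k<n. f (d k))" for f :: "real \<Rightarrow> real"
  proof -
    have "(\<Sum>x\<leftarrow>xs. f x) = sum_mset (image_mset f (mset xs))" by (simp flip: sum_mset_sum_list)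
    also have "\<dots> = (\<Sum>k\<leftarrow>[0..<n]. f (d k))"
      unfolding mset_xs by (simp add: image_mset.compositionality o_def flip: sum_mset_sum_list)
    finally show ?thesis by (simp add: interv_sum_list_conv_sum_set_nat atLeast0LessThan)
  qed
  have count: "count_list (eigvals A) (complex_of_real x) = count_list xs x" for x
    unfolding eigvals_xs by (rule count_list_map_inj) (simp add: inj_on_def)
  have \<kappa>: "\<kappa> = count_list xs 0"
    using mat_nullity_eq_count[OF A] assms(7) count[of 0] by simp
  define ys where "ys = filter (\<lambda>x. x \<noteq> 0) (remove1 \<rho> xs)"
  have nz: "0 \<notin> set ys" by (simp add: ys_def)
  have "filter (\<lambda>e. e \<noteq> 0) (eigvals A) = map complex_of_real (filter (\<lambda>x. x \<noteq> 0) xs)"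
    by (simp add: eigvals_xs filter_map o_def)
  then have "esym_eigvals (n - \<kappa>) A = complex_of_real (prod_list (filter (\<lambda>x. x \<noteq> 0) xs))"
    using esym_eigvals_eq_prod_nonzero[OF A] unfolding assms(7) of_real_hom.hom_prod_list by simp
  moreover have "mat_energy A = (\<Sum>x\<leftarrow>xs. \<bar>x\<bar>)"
    by (simp add: mat_energy_def eigvals_xs o_def)
  ultimately have gap: "mat_energy A - B = (\<Sum>y\<leftarrow>ys. \<bar>y\<bar> - 1 - ln \<bar>y\<bar>)"
    using energy_gap[OF \<rho>_mem \<rho>] assms(8) by (simp add: len \<kappa> ys_def)
  have ge: "B \<le> mat_energy A" using gap sum_sub_ln_nonneg(1)[OF nz] by linarith
  have eq_iff: "mat_energy A = B \<longleftrightarrow> (\<forall>y\<in>set ys. \<bar>y\<bar> = 1)"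
    using gap sum_sub_ln_nonneg(2)[OF nz] by auto
  have "remove1 (complex_of_real \<rho>) (eigvals A) = map complex_of_real (remove1 \<rho> xs)"
    unfolding eigvals_xs by (rule remove1_map_inj) (simp add: inj_on_def)
  then have equality: "mat_energy A = B \<longleftrightarrow>
      (\<forall>e \<in> set (remove1 (complex_of_real (largest_eigenvalue R)) (eigvals A)). e \<noteq> 0 \<longrightarrow> cmod e = 1)"
    unfolding largest eq_iff by (auto simp: ys_def)
  have counts: "real (count_list (eigvals A) (- 1)) = ((frobenius_norm A)\<^sup>2 - \<rho>\<^sup>2 + \<rho>) / 2 \<and>
      real (count_list (eigvals A) 1) = ((frobenius_norm A)\<^sup>2 - \<rho>\<^sup>2 - \<rho>) / 2 \<and>
      real \<kappa> = real n - 1 + \<rho>\<^sup>2 - (frobenius_norm A)\<^sup>2"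
    if "mat_energy A = B" "1 < \<rho>" "mat_trace R = 0"
  proof -
    have ys: "\<forall>y\<in>set ys. \<bar>y\<bar> = 1" using that(1) eq_iff by blast
    \<comment> \<open>Removing a copy of \<open>\<rho>\<close> leaves other counts unchanged. As
      \<open>\<rho> > 1\<close>, this covers both \<open>1\<close> and \<open>- 1\<close>.\<close>
    have "count_list ys x = count_list (eigvals A) (complex_of_real x)" if "x \<noteq> 0" "x \<noteq> \<rho>" for x
      using that count_list_filter[of "\<lambda>x. x \<noteq> 0" x] count_list_remove1[of x \<rho> xs] count[of x]
      by (simp add: ys_def)
    from this[of "- 1"] this[of 1] that(2)
    have c: "count_list ys (- 1) = count_list (eigvals A) (- 1)"
      "count_list ys 1 = count_list (eigvals A) 1" by auto
    have "(\<Sum>k<n. d k) = 0" using that(3) mat_trace_orth_diag[OF U R] by simp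
    then have "\<rho> + sum_list ys = 0"
      using sum_xs[of "\<lambda>x. x"] sum_list_nonzero_remove1[OF \<rho>_mem, of "\<lambda>x. x"] \<rho> by (simp add: ys_def)
    moreover have "(frobenius_norm A)\<^sup>2 = \<rho>\<^sup>2 + (\<Sum>y\<leftarrow>ys. y\<^sup>2)"
      using frobenius_norm_orth_diag[OF U R R_sym] sum_xs[of "\<lambda>x. x\<^sup>2"]
        sum_list_nonzero_remove1[OF \<rho>_mem, of "\<lambda>x. x\<^sup>2"] \<rho> by (simp add: ys_def A_def)
    moreover have "real n = real \<kappa> + 1 + real (length ys)"
      using length_nonzero_remove1[OF \<rho>_mem] \<rho> by (simp add: len \<kappa> ys_def)
    ultimately show ?thesis
      using sign_list_counts[OF ys] unfolding c by (simp add: field_simps)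
  qed
  have strict: "B < mat_energy A"
    if sub: "submatrix R I J = mat_of_rows_list 3 [[0, a, c], [a, 0, b], [c, b, 0]]"
      and quot: "2 * (a * \<alpha> * \<beta> + b * \<beta> * \<gamma> + c * \<alpha> * \<gamma>) / (\<alpha>\<^sup>2 + \<beta>\<^sup>2 + \<gamma>\<^sup>2) < - 1"
    for I J a b c \<alpha> \<beta> \<gamma>
  proof (rule ccontr)
    assume "\<not> ?thesis"
    then have ys: "\<forall>y\<in>set ys. \<bar>y\<bar> = 1" using ge eq_iff by linarith
    \<comment> \<open>Deleting one copy of \<open>\<rho>\<close> from the list amounts to deleting
      the index \<open>m\<close>, so the values at all other indices are controlled even if
      \<open>\<rho>\<close> is a multiple eigenvalue.\<close>
    have "add_mset \<rho> (mset (remove1 \<rho> xs)) = mset xs" using \<rho>_mem by simp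
    also have "\<dots> = image_mset d (mset_set {..<n})"
      by (simp add: mset_xs atLeast0LessThan)
    also have "mset_set {..<n} = add_mset m (mset_set ({..<n} - {m}))"
      using m(1) by (simp add: mset_set.remove)
    finally have "mset (remove1 \<rho> xs) = image_mset d (mset_set ({..<n} - {m}))"
      by (simp add: m(2))
    then have "set_mset (mset (remove1 \<rho> xs)) = d ` ({..<n} - {m})" by (simp only: set_image_mset) simp
    then have rest: "set (remove1 \<rho> xs) = d ` ({..<n} - {m})" unfolding set_mset_mset .
    have small: "\<bar>d k\<bar> \<le> 1" if "k < n" "k \<noteq> m" for k
    proof (cases "d k = 0")
      case False
      then have "d k \<in> set ys" using that by (simp add: ys_def rest)
      then show ?thesis using ys by simp
    qed simp
    \<comment> \<open>Division by zero yields \<open>0\<close>, so a quotient below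
      \<open>- 1\<close> already rules out the zero vector.\<close>
    have "\<alpha>\<^sup>2 + \<beta>\<^sup>2 + \<gamma>\<^sup>2 \<noteq> 0" using quot by auto
    then have "0 < \<alpha>\<^sup>2 + \<beta>\<^sup>2 + \<gamma>\<^sup>2" by (smt (verit) zero_le_power2)
    then have "2 * (a * \<alpha> * \<beta> + b * \<beta> * \<gamma> + c * \<alpha> * \<gamma>) < - (\<alpha>\<^sup>2 + \<beta>\<^sup>2 + \<gamma>\<^sup>2)"
      using quot by (simp add: pos_divide_less_eq)
    then show False
      using submatrix_rayleigh_ge[OF U R nonneg m(1) small sub hollow_symmetric_3_quadratic_form(1-2)
          hollow_symmetric_3_quadratic_form(3)[of \<alpha> \<beta> \<gamma>]]
      unfolding hollow_symmetric_3_quadratic_form(4,5) by linarith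
  qed
  have path: "B < mat_energy A"
    if sub: "submatrix R I J = mat_of_rows_list 3 [[0, a, 0], [a, 0, b], [0, b, 0]]"
      and "1 < sqrt (a\<^sup>2 + b\<^sup>2)" for I J a b
  proof (rule strict[OF sub])
    \<comment> \<open>The path matrix maps \<open>(a, - s, b)\<close> to \<open>- s\<close> times
      itself, because \<open>a\<^sup>2 + b\<^sup>2 = s\<^sup>2\<close>. The Rayleigh quotient of
      this eigenvector is therefore exactly \<open>- s\<close>.\<close>
    define s where "s = sqrt (a\<^sup>2 + b\<^sup>2)"
    have s: "a\<^sup>2 + b\<^sup>2 = s\<^sup>2" "1 < s" using that(2) by (simp_all add: s_def)
    have "2 * (a * a * - s + b * - s * b + 0 * a * b) = - s * (2 * (a\<^sup>2 + b\<^sup>2))"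
      by (simp add: power2_eq_square algebra_simps)
    also have "\<dots> = - s * (2 * s\<^sup>2)" unfolding s(1) ..
    also have norm: "2 * s\<^sup>2 = a\<^sup>2 + (- s)\<^sup>2 + b\<^sup>2" using s(1) by simp
    finally have "2 * (a * a * - s + b * - s * b + 0 * a * b) = - s * (a\<^sup>2 + (- s)\<^sup>2 + b\<^sup>2)" .
    moreover have "a\<^sup>2 + (- s)\<^sup>2 + b\<^sup>2 \<noteq> 0" unfolding norm[symmetric] using s(2) by simp
    ultimately have "2 * (a * a * - s + b * - s * b + 0 * a * b) / (a\<^sup>2 + (- s)\<^sup>2 + b\<^sup>2) = - s"
      by (metis nonzero_mult_div_cancel_right)
    then show "2 * (a * a * - s + b * - s * b + 0 * a * b) / (a\<^sup>2 + (- s)\<^sup>2 + b\<^sup>2) < - 1"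
      using s(2) by linarith
  qed
  show ?thesis
    using ge equality counts strict path unfolding largest by blast
qed

end
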